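(* Any plane curve $\alpha=(x,z)$, with $x$ non-constant, is uniquely determined by its geometric linear momentum as a function of its (signed) distance to the $z$-axis, that is, by $\mathcal K=\mathcal K(x)$. The uniqueness is modulo translations in the $z$-direction: if two such curves have the same momentum function $\mathcal K(x)$ on the same interval of values of $x$, then they differ by a translation in the $z$-direction (and a translation of the arc-length parameter). Moreover, the curvature of $\alpha$ is given by $\kappa(x)=\mathcal K'(x)$.
   Context: Let $\alpha(s)=(x(s),z(s))$, $s\in I\subseteq\mathbb{R}$, be a smooth plane curve parametrized by arc length, with Cartesian coordinates $(x,z)$ on $\mathbb{R}^2$. Its signed curvature is $\kappa(s)=\det(\dot\alpha(s),\ddot\alpha(s))=\dot x\ddot z-\dot z\ddot x$. The coordinate $x$ is the signed distance to the $z$-axis. The geometric linear momentum of $\alpha$ (with respect to the $z$-axis) is $\mathcal K(s)=\langle\dot\alpha(s),(0,1)\rangle=\dot z(s)$. When $x$ is non-constant one works on arcs where $\dot x\neq0$, oriented so that $\dot x=\sqrt{1-\mathcal K^2}>0$; then $s$ can be expressed as a function of $x$, and $\mathcal K$ and $\kappa$ are regarded as functions of $x$, with $-1<\mathcal K(x)<1$. The prime denotes $d/dx$. *)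

theory Defs
  imports "HOL-Analysis.Analysis"
begin

text \<open>
  A plane curve is a map \<open>\<alpha> = (x, z) :: real \<Rightarrow> real \<times> real\<close> considered on a parameter interval \<open>I\<close>,
  which may or may not contain its end points. All derivatives are taken within \<open>I\<close>, so they are
  one-sided at end points and do not depend on the values of \<open>\<alpha>\<close> outside \<open>I\<close>.
\<close>

definition proper_interval :: "real set \<Rightarrow> bool" where
  "proper_interval I \<longleftrightarrow> is_interval I \<and> interior I \<noteq> {}"

definition velocity :: "real set \<Rightarrow> (real \<Rightarrow> real \<times> real) \<Rightarrow> real \<Rightarrow> real \<times> real" where
  "velocity I \<alpha> = (\<lambda>s. vector_derivative \<alpha> (at s within I))"

definition acceleration :: "real set \<Rightarrow> (real \<Rightarrow> real \<times> real) \<Rightarrow> real \<Rightarrow> real \<times> real" where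
  "acceleration I \<alpha> = velocity I (velocity I \<alpha>)"

definition smooth_curve :: "real set \<Rightarrow> (real \<Rightarrow> real \<times> real) \<Rightarrow> bool" where
  "smooth_curve I \<alpha> \<longleftrightarrow> (\<forall>n. (velocity I ^^ n) \<alpha> differentiable_on I)"

definition arc_length_curve :: "real set \<Rightarrow> (real \<Rightarrow> real \<times> real) \<Rightarrow> bool" where
  "arc_length_curve I \<alpha> \<longleftrightarrow>
     proper_interval I \<and> smooth_curve I \<alpha> \<and> (\<forall>s\<in>I. norm (velocity I \<alpha> s) = 1)"

definition curvature :: "real set \<Rightarrow> (real \<Rightarrow> real \<times> real) \<Rightarrow> real \<Rightarrow> real" where
  "curvature I \<alpha> s =
     fst (velocity I \<alpha> s) * snd (acceleration I \<alpha> s)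
       - snd (velocity I \<alpha> s) * fst (acceleration I \<alpha> s)"

definition momentum :: "real set \<Rightarrow> (real \<Rightarrow> real \<times> real) \<Rightarrow> real \<Rightarrow> real" where
  "momentum I \<alpha> s = velocity I \<alpha> s \<bullet> (0, 1)"

text \<open>
  \<open>\<gamma>\<close> on \<open>A\<close> is an arc of the curve \<open>\<alpha>\<close> on \<open>I\<close> along which the derivative of \<open>x\<close> does not vanish,
  traversed in the direction of increasing \<open>x\<close>. The second alternative reverses the
  parametrization; it serves the arcs of \<open>\<alpha>\<close> along which \<open>x\<close> decreases.
\<close>

definition oriented_arc ::
  "real set \<Rightarrow> (real \<Rightarrow> real \<times> real) \<Rightarrow> real set \<Rightarrow> (real \<Rightarrow> real \<times> real) \<Rightarrow> bool" where
  "oriented_arc I \<alpha> A \<gamma> \<longleftrightarrow>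
     proper_interval A \<and>
     (\<gamma> = \<alpha> \<and> A \<subseteq> I \<or> \<gamma> = (\<lambda>s. \<alpha> (- s)) \<and> uminus ` A \<subseteq> I) \<and>
     (\<forall>s\<in>A. fst (velocity A \<gamma> s) > 0)"

definition x_range :: "real set \<Rightarrow> (real \<Rightarrow> real \<times> real) \<Rightarrow> real set" where
  "x_range A \<gamma> = (\<lambda>s. fst (\<gamma> s)) ` A"

text \<open>
  The parameter, the momentum and the curvature of an oriented arc as functions of \<open>x\<close>. They are
  meaningful on \<open>x_range A \<gamma>\<close> when \<open>x\<close> is injective on \<open>A\<close>.
\<close>

definition param_of_x :: "real set \<Rightarrow> (real \<Rightarrow> real \<times> real) \<Rightarrow> real \<Rightarrow> real" where
  "param_of_x A \<gamma> = the_inv_into A (\<lambda>s. fst (\<gamma> s))"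

definition momentum_of_x :: "real set \<Rightarrow> (real \<Rightarrow> real \<times> real) \<Rightarrow> real \<Rightarrow> real" where
  "momentum_of_x A \<gamma> u = momentum A \<gamma> (param_of_x A \<gamma> u)"

definition curvature_of_x :: "real set \<Rightarrow> (real \<Rightarrow> real \<times> real) \<Rightarrow> real \<Rightarrow> real" where
  "curvature_of_x A \<gamma> u = curvature A \<gamma> (param_of_x A \<gamma> u)"

end

theory Submission
  imports Defs
begin

text \<open>
  Let \<open>s\<close> be the arc length on an arc with \<open>x' > 0\<close>. Since \<open>x'\<^sup>2 + z'\<^sup>2 = 1\<close>, the momentum
  \<open>K = z'\<close> also fixes the other velocity component: \<open>x' = sqrt (1 - K\<^sup>2)\<close>. Both claims of the
  theorem are read off from this.

  Curvature: differentiating \<open>x'\<^sup>2 + z'\<^sup>2 = 1\<close> gives \<open>x' x'' + z' z'' = 0\<close>, which turns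
  \<open>\<kappa> = x' z'' - z' x''\<close> into \<open>z'' / x'\<close> (lemma \<open>curvature_eq\<close>). As \<open>s\<close> has derivative \<open>1 / x'\<close> with
  respect to \<open>x\<close> (lemma \<open>param_of_x_deriv\<close>), this is the derivative of \<open>z'\<close> with respect to \<open>x\<close>.

  Uniqueness: send a point of one arc to the point of the other arc with the same abscissa. The two
  points have the same \<open>K\<close>, hence the same velocity. So the change of parameter
  has derivative \<open>1\<close> and is a translation (lemma \<open>param_shift\<close>), and after this translation the two
  ordinates have equal derivatives, so they differ by a constant.

  An oriented arc is a piece of the given curve or of its reversal. The preliminary lemmas show that
  restricting the parameter interval and reversing the parameter yield an arc length curve again,
  so that the arguments above concern a single kind of object, the locale \<open>rising_arc\<close>. An arc exists
  because \<open>x'\<close> is continuous and does not vanish identically.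
\<close>

section \<open>Derivatives within intervals\<close>

text \<open>
  A connected set with more than one point has no isolated points. This makes derivatives within a
  proper interval unique, also at its end points.
\<close>

lemma proper_interval_at_within_neq_bot:
  assumes "proper_interval I" "s \<in> I"
  shows "at s within I \<noteq> bot"
proof -
  have "connected I" "I \<noteq> {s}"
    using assms by (auto simp: proper_interval_def is_interval_connected)
  then show ?thesis
    using assms(2) connected_imp_perfect by (auto simp: trivial_limit_within)
qed

lemma velocity_eqI:
  assumes "proper_interval I" "s \<in> I" "(\<alpha> has_vector_derivative v) (at s within I)"
  shows "velocity I \<alpha> s = v"
  unfolding velocity_def
  using vector_derivative_within assms proper_interval_at_within_neq_bot by blast

lemma has_vector_derivative_velocity:
  assumes "\<alpha> differentiable_on I" "s \<in> I"
  shows "(\<alpha> has_vector_derivative velocity I \<alpha> s) (at s within I)"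
  using assms unfolding velocity_def differentiable_on_def by (simp add: vector_derivative_works)

lemma proper_interval_uminus:
  "proper_interval I \<Longrightarrow> proper_interval (uminus ` I)"
  by (simp add: proper_interval_def interior_negations)

lemma constant_on_if_deriv_zero:
  fixes f :: "real \<Rightarrow> real"
  assumes "proper_interval A" "\<And>s. s \<in> A \<Longrightarrow> (f has_real_derivative 0) (at s within A)"
  obtains c where "\<And>s. s \<in> A \<Longrightarrow> f s = c"
proof -
  have "convex A"
    using assms(1) by (simp add: proper_interval_def is_interval_convex)
  then show thesis
    using has_field_derivative_zero_constant[of A f] assms(2) that by blast
qed

lemma differentiable_on_transform:
  assumes "f differentiable_on S" "\<And>x. x \<in> S \<Longrightarrow> f x = g x"
  shows "g differentiable_on S"
  using assms differentiable_transform_within[of f _ S 1 g] by (auto simp: differentiable_on_def)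

section \<open>Restriction and reversal of a curve\<close>

text \<open>
  A derivative within \<open>I\<close> is also one within \<open>A\<close>, and the latter is unique because \<open>A\<close> has no isolated
  points. All orders are needed because smoothness quantifies over all iterated velocities.
\<close>

lemma velocity_iterate_subset:
  assumes A: "proper_interval A" "A \<subseteq> I" and \<alpha>: "smooth_curve I \<alpha>" and s: "s \<in> A"
  shows "(velocity A ^^ n) \<alpha> s = (velocity I ^^ n) \<alpha> s"
  using s
proof (induction n arbitrary: s)
  case (Suc n)
  have "((velocity I ^^ n) \<alpha> has_vector_derivative (velocity I ^^ Suc n) \<alpha> s) (at s within I)"
    using has_vector_derivative_velocity[of "(velocity I ^^ n) \<alpha>" I s] \<alpha> A Suc.prems
    by (auto simp: smooth_curve_def)
  then have "((velocity I ^^ n) \<alpha> has_vector_derivative (velocity I ^^ Suc n) \<alpha> s) (at s within A)"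
    using A(2) has_vector_derivative_within_subset by blast
  then have "((velocity A ^^ n) \<alpha> has_vector_derivative (velocity I ^^ Suc n) \<alpha> s) (at s within A)"
    by (rule has_vector_derivative_transform[OF Suc.prems, rotated]) (simp add: Suc.IH)
  then show ?case
    using velocity_eqI[OF A(1) Suc.prems] by simp
qed simp

lemma arc_length_curve_subset:
  assumes A: "proper_interval A" "A \<subseteq> I" and \<alpha>: "arc_length_curve I \<alpha>"
  shows "arc_length_curve A \<alpha>"
proof -
  have sm: "smooth_curve I \<alpha>" using \<alpha> by (simp add: arc_length_curve_def)
  have "(velocity A ^^ n) \<alpha> differentiable_on A" for n
  proof -
    have "(velocity I ^^ n) \<alpha> differentiable_on A"
      using sm A(2) unfolding smooth_curve_def by (blast intro: differentiable_on_subset)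
    then show ?thesis
      by (rule differentiable_on_transform) (simp add: velocity_iterate_subset[OF A sm])
  qed
  moreover have "norm (velocity A \<alpha> s) = 1" if "s \<in> A" for s
    using velocity_iterate_subset[OF A sm that, of 1] \<alpha> A(2) that
    by (auto simp: arc_length_curve_def)
  ultimately show ?thesis
    using A(1) by (auto simp: arc_length_curve_def smooth_curve_def)
qed

lemma has_vector_derivative_reverse:
  assumes "(f has_vector_derivative v) (at s within I)"
  shows "((\<lambda>t. f (- t)) has_vector_derivative - v) (at (- s) within uminus ` I)"
proof -
  have "(uminus has_vector_derivative (- 1::real)) (at (- s) within uminus ` I)"
    by (auto intro!: derivative_eq_intros)
  moreover have "(f has_vector_derivative v) (at (- (- s)) within uminus ` uminus ` I)"
    using assms by (simp add: image_image)
  ultimately show ?thesis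
    using vector_diff_chain_within[of uminus "- 1" "- s" "uminus ` I" f v] by (simp add: o_def)
qed

text \<open>Each differentiation of the reversed curve contributes one sign, by the chain rule.\<close>

lemma velocity_iterate_reverse:
  assumes I: "proper_interval I" and \<alpha>: "smooth_curve I \<alpha>" and s: "s \<in> I"
  shows "(velocity (uminus ` I) ^^ n) (\<lambda>t. \<alpha> (- t)) (- s) = (- 1) ^ n *\<^sub>R (velocity I ^^ n) \<alpha> s"
  using s
proof (induction n arbitrary: s)
  case (Suc n)
  let ?f = "(velocity I ^^ n) \<alpha>" and ?g = "(velocity (uminus ` I) ^^ n) (\<lambda>t. \<alpha> (- t))"
  have "(?f has_vector_derivative (velocity I ^^ Suc n) \<alpha> s) (at s within I)"
    using has_vector_derivative_velocity[of ?f I s] \<alpha> Suc.prems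
    by (auto simp: smooth_curve_def)
  then have "((\<lambda>t. (- 1) ^ n *\<^sub>R ?f (- t)) has_vector_derivative
      (- 1) ^ n *\<^sub>R (- (velocity I ^^ Suc n) \<alpha> s)) (at (- s) within uminus ` I)"
    by (intro bounded_linear.has_vector_derivative[OF bounded_linear_scaleR_right]
        has_vector_derivative_reverse)
  then have "(?g has_vector_derivative
      (- 1) ^ n *\<^sub>R (- (velocity I ^^ Suc n) \<alpha> s)) (at (- s) within uminus ` I)"
    by (rule has_vector_derivative_transform[rotated 2]) (use Suc in auto)
  then show ?case
    using velocity_eqI[OF proper_interval_uminus[OF I], of "- s"] Suc.prems by simp
qed simp

lemma arc_length_curve_reverse:
  assumes \<alpha>: "arc_length_curve I \<alpha>"
  shows "arc_length_curve (uminus ` I) (\<lambda>s. \<alpha> (- s))"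
proof -
  have I: "proper_interval I" and sm: "smooth_curve I \<alpha>"
    using \<alpha> by (auto simp: arc_length_curve_def)
  have "(velocity (uminus ` I) ^^ n) (\<lambda>t. \<alpha> (- t)) differentiable_on uminus ` I" for n
  proof -
    have "(\<lambda>t. (velocity I ^^ n) \<alpha> (- t)) differentiable (at (- s) within uminus ` I)"
      if "s \<in> I" for s
      using has_vector_derivative_reverse[OF has_vector_derivative_velocity[of _ I s]]
        that sm differentiableI_vector by (force simp: smooth_curve_def)
    then have "(\<lambda>t. (- 1) ^ n *\<^sub>R (velocity I ^^ n) \<alpha> (- t)) differentiable_on uminus ` I"
      by (auto simp: differentiable_on_def)
    then show ?thesis
      by (rule differentiable_on_transform) (auto simp: velocity_iterate_reverse[OF I sm])
  qed
  moreover have "norm (velocity (uminus ` I) (\<lambda>t. \<alpha> (- t)) (- s)) = 1" if "s \<in> I" for s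
    using velocity_iterate_reverse[OF I sm that, of 1] \<alpha> that
    by (simp add: arc_length_curve_def)
  ultimately show ?thesis
    using proper_interval_uminus[OF I] by (auto simp: arc_length_curve_def smooth_curve_def)
qed

lemma oriented_arc_reverse:
  assumes "oriented_arc (uminus ` I) (\<lambda>s. \<alpha> (- s)) A (\<lambda>s. \<alpha> (- s))" "A \<subseteq> uminus ` I"
  shows "oriented_arc I \<alpha> A (\<lambda>s. \<alpha> (- s))"
  using assms by (force simp: oriented_arc_def)

lemma oriented_arc_arc_length_curve:
  assumes "oriented_arc I \<alpha> A \<gamma>" "arc_length_curve I \<alpha>"
  shows "arc_length_curve A \<gamma>"
proof -
  have "A \<subseteq> uminus ` I" if "uminus ` A \<subseteq> I"
    using that by force
  then show ?thesis
    using assms arc_length_curve_subset arc_length_curve_reverse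
    unfolding oriented_arc_def by metis
qed

section \<open>Existence of an oriented arc\<close>

lemma
  assumes \<alpha>: "arc_length_curve I \<alpha>" and s: "s \<in> I"
  shows arc_length_curve_velocity: "(\<alpha> has_vector_derivative velocity I \<alpha> s) (at s within I)"
    and arc_length_curve_acceleration:
      "(velocity I \<alpha> has_vector_derivative acceleration I \<alpha> s) (at s within I)"
proof -
  have "(velocity I ^^ n) \<alpha> differentiable_on I" for n
    using \<alpha> by (simp add: arc_length_curve_def smooth_curve_def)
  from this[of 0] this[of 1]
  show "(\<alpha> has_vector_derivative velocity I \<alpha> s) (at s within I)"
    "(velocity I \<alpha> has_vector_derivative acceleration I \<alpha> s) (at s within I)"
    using s by (simp_all add: has_vector_derivative_velocity acceleration_def)
qed

lemma has_vector_derivative_prodD: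
  fixes f :: "real \<Rightarrow> real \<times> real"
  assumes "(f has_vector_derivative v) F"
  shows "((\<lambda>s. fst (f s)) has_real_derivative fst v) F"
    and "((\<lambda>s. snd (f s)) has_real_derivative snd v) F"
  using bounded_linear.has_vector_derivative[OF bounded_linear_fst assms]
    bounded_linear.has_vector_derivative[OF bounded_linear_snd assms]
  by (simp_all add: has_real_derivative_iff_has_vector_derivative)

text \<open>
  Cutting \<open>I\<close> down to a ball keeps it proper even around an end point, because an interval with
  interior points lies in the closure of its interior.
\<close>

lemma proper_interval_Int_ball:
  assumes I: "proper_interval I" and "s \<in> I" "0 < e"
  shows "proper_interval (I \<inter> ball s e)"
proof -
  have "convex I" "interior I \<noteq> {}"
    using I by (auto simp: proper_interval_def is_interval_convex_1)
  then have "s \<in> closure (interior I)"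
    using \<open>s \<in> I\<close> closure_subset convex_closure_interior by fastforce
  then obtain t where "t \<in> interior I" "dist t s < e"
    using \<open>0 < e\<close> closure_approachable by blast
  then have "t \<in> interior (I \<inter> ball s e)"
    by (simp add: dist_commute)
  then show ?thesis
    using I by (auto simp: proper_interval_def is_interval_convex_1 convex_Int)
qed

text \<open>The acceleration exists, so \<open>x'\<close> is continuous and stays positive near \<open>s\<close>.\<close>

lemma oriented_arc_near:
  assumes \<alpha>: "arc_length_curve I \<alpha>" and s: "s \<in> I" and pos: "0 < fst (velocity I \<alpha> s)"
  obtains A where "A \<subseteq> I" "oriented_arc I \<alpha> A \<alpha>"
proof -
  have I: "proper_interval I" and sm: "smooth_curve I \<alpha>"
    using \<alpha> by (auto simp: arc_length_curve_def)
  have "continuous (at s within I) (\<lambda>s. fst (velocity I \<alpha> s))"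
    using has_vector_derivative_continuous[OF arc_length_curve_acceleration[OF \<alpha> s]]
    by (rule continuous_fst)
  then obtain e where e: "0 < e"
    "\<And>t. t \<in> I \<Longrightarrow> dist t s < e \<Longrightarrow> dist (fst (velocity I \<alpha> t)) (fst (velocity I \<alpha> s)) < fst (velocity I \<alpha> s)"
    unfolding continuous_within_eps_delta using pos by blast
  let ?A = "I \<inter> ball s e"
  have A: "proper_interval ?A" "?A \<subseteq> I"
    using proper_interval_Int_ball[OF I s e(1)] by auto
  have "0 < fst (velocity ?A \<alpha> t)" if "t \<in> ?A" for t
    using e(2)[of t] that velocity_iterate_subset[OF A sm that, of 1]
    by (auto simp: dist_commute) (auto simp: dist_real_def abs_if split: if_splits)
  then show thesis
    using A that[of ?A] by (auto simp: oriented_arc_def)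
qed

text \<open>
  If \<open>x'\<close> vanished on all of \<open>I\<close>, then \<open>x\<close> would be constant. Around a point where \<open>x' < 0\<close>, the
  reversed curve supplies the arc.
\<close>

lemma oriented_arc_exists:
  assumes \<alpha>: "arc_length_curve I \<alpha>" and nonconst: "\<not> (\<lambda>s. fst (\<alpha> s)) constant_on I"
  shows "\<exists>A \<gamma>. oriented_arc I \<alpha> A \<gamma>"
proof -
  have I: "proper_interval I" and sm: "smooth_curve I \<alpha>"
    using \<alpha> by (auto simp: arc_length_curve_def)
  obtain s where s: "s \<in> I" "fst (velocity I \<alpha> s) \<noteq> 0"
    using constant_on_if_deriv_zero[OF I, of "\<lambda>s. fst (\<alpha> s)"] nonconst
      has_vector_derivative_prodD(1)[OF arc_length_curve_velocity[OF \<alpha>]]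
    unfolding constant_on_def by metis
  show ?thesis
  proof (cases "0 < fst (velocity I \<alpha> s)")
    case True
    then show ?thesis
      using oriented_arc_near[OF \<alpha> s(1)] by metis
  next
    case False
    have "fst (velocity (uminus ` I) (\<lambda>t. \<alpha> (- t)) (- s)) = - fst (velocity I \<alpha> s)"
      using velocity_iterate_reverse[OF I sm s(1), of 1] by simp
    then have "0 < fst (velocity (uminus ` I) (\<lambda>t. \<alpha> (- t)) (- s))"
      using False s(2) by simp
    then show ?thesis
      using oriented_arc_near[OF arc_length_curve_reverse[OF \<alpha>], of "- s"] s(1)
        oriented_arc_reverse by (metis imageI)
  qed
qed

section \<open>Arcs along which the abscissa increases\<close>

locale rising_arc =
  fixes A :: "real set" and \<gamma> :: "real \<Rightarrow> real \<times> real"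
  assumes arc_length: "arc_length_curve A \<gamma>"
    and rising: "s \<in> A \<Longrightarrow> 0 < fst (velocity A \<gamma> s)"
begin

lemma proper: "proper_interval A"
  using arc_length by (simp add: arc_length_curve_def)

lemmas x_deriv = has_vector_derivative_prodD(1)[OF arc_length_curve_velocity[OF arc_length]]
lemmas z_deriv = has_vector_derivative_prodD(2)[OF arc_length_curve_velocity[OF arc_length]]
lemmas x_deriv2 = has_vector_derivative_prodD(1)[OF arc_length_curve_acceleration[OF arc_length]]
lemmas z_deriv2 = has_vector_derivative_prodD(2)[OF arc_length_curve_acceleration[OF arc_length]]

lemma momentum_eq: "momentum A \<gamma> s = snd (velocity A \<gamma> s)"
  by (simp add: momentum_def inner_prod_def)

lemma unit_speed:
  assumes "s \<in> A"
  shows "(fst (velocity A \<gamma> s))\<^sup>2 + (snd (velocity A \<gamma> s))\<^sup>2 = 1"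
  using arc_length assms by (simp add: arc_length_curve_def norm_prod_def)

lemma x_velocity_eq:
  assumes "s \<in> A"
  shows "fst (velocity A \<gamma> s) = sqrt (1 - (momentum A \<gamma> s)\<^sup>2)"
proof -
  have "1 - (momentum A \<gamma> s)\<^sup>2 = (fst (velocity A \<gamma> s))\<^sup>2"
    using unit_speed[OF assms] by (simp add: momentum_eq algebra_simps)
  then show ?thesis
    using rising[OF assms] by simp
qed

lemma abs_momentum_less_1:
  assumes "s \<in> A"
  shows "\<bar>momentum A \<gamma> s\<bar> < 1"
proof -
  have "0 < (fst (velocity A \<gamma> s))\<^sup>2"
    using rising[OF assms] by simp
  then have "(momentum A \<gamma> s)\<^sup>2 < 1"
    using unit_speed[OF assms] unfolding momentum_eq by linarith
  then show ?thesis
    by (simp add: abs_square_less_1)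
qed

text \<open>The acceleration is orthogonal to the velocity because the speed is constant.\<close>

lemma velocity_acceleration_orthogonal:
  assumes s: "s \<in> A"
  shows "fst (velocity A \<gamma> s) * fst (acceleration A \<gamma> s)
    + snd (velocity A \<gamma> s) * snd (acceleration A \<gamma> s) = 0"
proof -
  let ?q = "\<lambda>t. (fst (velocity A \<gamma> t))\<^sup>2 + (snd (velocity A \<gamma> t))\<^sup>2"
  have "(?q has_real_derivative 2 * (fst (velocity A \<gamma> s) * fst (acceleration A \<gamma> s)
      + snd (velocity A \<gamma> s) * snd (acceleration A \<gamma> s))) (at s within A)"
    using x_deriv2[OF s] z_deriv2[OF s] by (auto intro!: derivative_eq_intros simp: algebra_simps)
  moreover have "(?q has_real_derivative 0) (at s within A)"
    unfolding has_real_derivative_iff_has_vector_derivative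
    by (rule has_vector_derivative_transform[OF s, of _ "\<lambda>_. 1"]) (simp_all add: unit_speed)
  ultimately have "2 * (fst (velocity A \<gamma> s) * fst (acceleration A \<gamma> s)
      + snd (velocity A \<gamma> s) * snd (acceleration A \<gamma> s)) = 0"
    unfolding has_real_derivative_iff_has_vector_derivative
    by (rule vector_derivative_unique_within[OF proper_interval_at_within_neq_bot[OF proper s]])
  then show ?thesis
    by simp
qed

lemma curvature_eq:
  assumes s: "s \<in> A"
  shows "curvature A \<gamma> s = snd (acceleration A \<gamma> s) / fst (velocity A \<gamma> s)"
proof -
  define x' z' x'' z'' where d: "x' = fst (velocity A \<gamma> s)" "z' = snd (velocity A \<gamma> s)"
    "x'' = fst (acceleration A \<gamma> s)" "z'' = snd (acceleration A \<gamma> s)"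
  have orth: "x' * x'' = - z' * z''" and unit: "x'\<^sup>2 + z'\<^sup>2 = 1" and "x' \<noteq> 0"
    using velocity_acceleration_orthogonal[OF s] unit_speed[OF s] rising[OF s] by (auto simp: d)
  have "(x' * z'' - z' * x'') * x' = x'\<^sup>2 * z'' - z' * (x' * x'')"
    by (simp add: algebra_simps power2_eq_square)
  also have "\<dots> = (x'\<^sup>2 + z'\<^sup>2) * z''"
    unfolding orth by (simp add: algebra_simps power2_eq_square)
  finally show ?thesis
    using unit \<open>x' \<noteq> 0\<close> unfolding curvature_def d by (simp add: eq_divide_eq)
qed

lemma x_inj: "inj_on (\<lambda>s. fst (\<gamma> s)) A"
proof (rule linorder_inj_onI')
  fix s t assume st: "s \<in> A" "t \<in> A" "s < t"
  then have sub: "{s..t} \<subseteq> A"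
    using proper unfolding proper_interval_def is_interval_1 by (meson atLeastAtMost_iff subsetI)
  have "((\<lambda>s. fst (\<gamma> s)) has_derivative (*) (fst (velocity A \<gamma> r))) (at r within {s..t})"
    if "s \<le> r" "r \<le> t" for r
    using has_field_derivative_subset[OF x_deriv sub] sub that
    by (auto simp: has_field_derivative_def)
  from mvt_simple[OF st(3) this] obtain r where r: "r \<in> {s<..<t}"
    "fst (\<gamma> t) - fst (\<gamma> s) = fst (velocity A \<gamma> r) * (t - s)"
    by blast
  moreover have "0 < fst (velocity A \<gamma> r) * (t - s)"
    using rising[OF subsetD[OF sub, of r]] r(1) st(3) by simp
  ultimately show "fst (\<gamma> s) \<noteq> fst (\<gamma> t)"
    by auto
qed

lemma param_of_x_apply: "s \<in> A \<Longrightarrow> param_of_x A \<gamma> (fst (\<gamma> s)) = s"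
  unfolding param_of_x_def using the_inv_into_f_f[OF x_inj] by simp

lemma param_of_x_mem: "u \<in> x_range A \<gamma> \<Longrightarrow> param_of_x A \<gamma> u \<in> A"
  by (auto simp: x_range_def param_of_x_apply)

lemma fst_param_of_x: "u \<in> x_range A \<gamma> \<Longrightarrow> fst (\<gamma> (param_of_x A \<gamma> u)) = u"
  by (auto simp: x_range_def param_of_x_apply)

text \<open>
  The inverse function rule needs the inverse to be continuous. It is, also at end points, because a
  continuous injective real function on an interval is a homeomorphism onto its image.
\<close>

lemma param_of_x_deriv:
  assumes s: "s \<in> A"
  shows "(param_of_x A \<gamma> has_real_derivative 1 / fst (velocity A \<gamma> s))
    (at (fst (\<gamma> s)) within x_range A \<gamma>)"
proof -
  let ?x = "\<lambda>s. fst (\<gamma> s)"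
  have "continuous_on A ?x"
    by (rule DERIV_continuous_on) (rule x_deriv)
  moreover have "path_connected A"
    using proper by (simp add: proper_interval_def is_interval_path_connected)
  ultimately have "\<exists>g. homeomorphism A (?x ` A) ?x g"
    by (rule iffD1[OF injective_into_1d_eq_homeomorphism x_inj])
  then obtain g where "homeomorphism A (?x ` A) ?x g"
    by blast
  then have "continuous_on (?x ` A) g" "\<And>t. t \<in> A \<Longrightarrow> g (?x t) = t"
    by (auto simp: homeomorphism_def)
  then have "continuous_on (?x ` A) (param_of_x A \<gamma>)"
    by (subst continuous_on_cong[OF refl, of _ _ g]) (auto simp: param_of_x_apply)
  then have "continuous (at (?x s) within ?x ` A) (param_of_x A \<gamma>)"
    using s by (simp add: continuous_on_eq_continuous_within)
  then have "(param_of_x A \<gamma> has_derivative (*) (1 / fst (velocity A \<gamma> s)))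
      (at (?x s) within ?x ` A)"
    using x_deriv[OF s, unfolded has_field_derivative_def] s rising[OF s] param_of_x_apply
    by (intro has_derivative_inverse_within) (auto simp: fun_eq_iff intro: bounded_linear.linear bounded_linear_divide)
  then show ?thesis
    by (simp add: has_field_derivative_def x_range_def)
qed

lemma momentum_of_x_deriv:
  assumes u: "u \<in> x_range A \<gamma>"
  shows "(momentum_of_x A \<gamma> has_real_derivative curvature_of_x A \<gamma> u) (at u within x_range A \<gamma>)"
proof -
  define s where "s = param_of_x A \<gamma> u"
  have s: "s \<in> A" "u = fst (\<gamma> s)"
    using u by (simp_all add: s_def param_of_x_mem fst_param_of_x)
  have range: "param_of_x A \<gamma> ` x_range A \<gamma> = A"
    by (force simp: x_range_def param_of_x_apply)
  have "((\<lambda>s. snd (velocity A \<gamma> s)) \<circ> param_of_x A \<gamma> has_real_derivative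
      snd (acceleration A \<gamma> s) * (1 / fst (velocity A \<gamma> s))) (at u within x_range A \<gamma>)"
    using z_deriv2[OF s(1)] param_of_x_deriv[OF s(1)]
    by (intro DERIV_image_chain) (simp_all add: range param_of_x_apply s)
  moreover have "(\<lambda>s. snd (velocity A \<gamma> s)) \<circ> param_of_x A \<gamma> = momentum_of_x A \<gamma>"
    by (simp add: fun_eq_iff momentum_eq momentum_of_x_def)
  ultimately show ?thesis
    using curvature_eq[OF s(1)] by (simp add: curvature_of_x_def flip: s_def)
qed

end

lemma oriented_arc_rising_arc:
  assumes "oriented_arc I \<alpha> A \<gamma>" "arc_length_curve I \<alpha>"
  shows "rising_arc A \<gamma>"
  using assms oriented_arc_arc_length_curve by (auto simp: rising_arc_def oriented_arc_def)

section \<open>Uniqueness\<close>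

text \<open>
  Points with the same abscissa have the same momentum, hence the same \<open>x'\<close>. So passing from one
  parameter to the other through the abscissa has derivative \<open>x' / x' = 1\<close>.
\<close>

lemma param_shift:
  assumes "rising_arc A \<gamma>" "rising_arc B \<delta>" and range: "x_range A \<gamma> = x_range B \<delta>"
    and mom: "\<And>u. u \<in> x_range A \<gamma> \<Longrightarrow> momentum_of_x A \<gamma> u = momentum_of_x B \<delta> u"
  obtains s\<^sub>0 where "B = (\<lambda>s. s + s\<^sub>0) ` A"
    "\<And>s. s \<in> A \<Longrightarrow> fst (\<delta> (s + s\<^sub>0)) = fst (\<gamma> s)"
    "\<And>s. s \<in> A \<Longrightarrow> momentum B \<delta> (s + s\<^sub>0) = momentum A \<gamma> s"
proof -
  interpret A: rising_arc A \<gamma> by fact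
  interpret B: rising_arc B \<delta> by fact
  define \<tau> where "\<tau> = param_of_x B \<delta> \<circ> (\<lambda>s. fst (\<gamma> s))"
  have xr: "fst (\<gamma> s) \<in> x_range B \<delta>" if "s \<in> A" for s
    using that range by (auto simp: x_range_def)
  have \<tau>B: "\<tau> s \<in> B" and \<tau>x: "fst (\<delta> (\<tau> s)) = fst (\<gamma> s)" if "s \<in> A" for s
    using xr[OF that] by (simp_all add: \<tau>_def B.param_of_x_mem B.fst_param_of_x)
  have \<tau>mom: "momentum B \<delta> (\<tau> s) = momentum A \<gamma> s" if "s \<in> A" for s
    using mom[of "fst (\<gamma> s)"] xr[OF that] that
    by (simp add: range momentum_of_x_def A.param_of_x_apply \<tau>_def)
  have "((\<lambda>s. \<tau> s - s) has_real_derivative 0) (at s within A)" if s: "s \<in> A" for s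
  proof -
    have "(param_of_x B \<delta> has_real_derivative 1 / fst (velocity B \<delta> (\<tau> s)))
        (at (fst (\<gamma> s)) within (\<lambda>s. fst (\<gamma> s)) ` A)"
      using B.param_of_x_deriv[OF \<tau>B[OF s]] unfolding \<tau>x[OF s] range[symmetric]
      by (simp add: x_range_def)
    then have "(\<tau> has_real_derivative 1 / fst (velocity B \<delta> (\<tau> s)) * fst (velocity A \<gamma> s))
        (at s within A)"
      unfolding \<tau>_def[abs_def] by (rule DERIV_image_chain) (rule A.x_deriv[OF s])
    moreover have "fst (velocity B \<delta> (\<tau> s)) = fst (velocity A \<gamma> s)"
      using A.x_velocity_eq[OF s] B.x_velocity_eq[OF \<tau>B[OF s]] \<tau>mom[OF s] by simp
    ultimately have "(\<tau> has_real_derivative 1) (at s within A)"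
      using A.rising[OF s] by simp
    then show ?thesis
      by (auto intro!: derivative_eq_intros)
  qed
  then obtain s\<^sub>0 where "\<And>s. s \<in> A \<Longrightarrow> \<tau> s - s = s\<^sub>0"
    using constant_on_if_deriv_zero[OF A.proper, of "\<lambda>s. \<tau> s - s"] by blast
  then have s\<^sub>0: "\<tau> s = s + s\<^sub>0" if "s \<in> A" for s
    using that by (simp add: algebra_simps flip: \<open>\<And>s. s \<in> A \<Longrightarrow> \<tau> s - s = s\<^sub>0\<close>)
  have "B \<subseteq> \<tau> ` A"
  proof
    fix t assume t: "t \<in> B"
    then have "fst (\<delta> t) \<in> x_range A \<gamma>"
      by (simp add: range) (simp add: x_range_def)
    then obtain s where "s \<in> A" "fst (\<delta> t) = fst (\<gamma> s)"
      by (auto simp: x_range_def)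
    then show "t \<in> \<tau> ` A"
      using B.param_of_x_apply[OF t] by (auto simp: \<tau>_def)
  qed
  then have "B = (\<lambda>s. s + s\<^sub>0) ` A"
    using \<tau>B s\<^sub>0 by force
  then show thesis
    using that[of s\<^sub>0] \<tau>x \<tau>mom s\<^sub>0 by metis
qed

text \<open>After the shift of the parameter, the ordinates of both arcs have the momentum as derivative.\<close>

lemma rising_arc_unique:
  assumes "rising_arc A \<gamma>" "rising_arc B \<delta>" and range: "x_range A \<gamma> = x_range B \<delta>"
    and mom: "\<And>u. u \<in> x_range A \<gamma> \<Longrightarrow> momentum_of_x A \<gamma> u = momentum_of_x B \<delta> u"
  shows "\<exists>s\<^sub>0 c. B = (\<lambda>s. s + s\<^sub>0) ` A \<and> (\<forall>s\<in>A. \<delta> (s + s\<^sub>0) = \<gamma> s + (0, c))"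
proof -
  interpret A: rising_arc A \<gamma> by fact
  interpret B: rising_arc B \<delta> by fact
  obtain s\<^sub>0 where B: "B = (\<lambda>s. s + s\<^sub>0) ` A"
    and x: "\<And>s. s \<in> A \<Longrightarrow> fst (\<delta> (s + s\<^sub>0)) = fst (\<gamma> s)"
    and K: "\<And>s. s \<in> A \<Longrightarrow> momentum B \<delta> (s + s\<^sub>0) = momentum A \<gamma> s"
    by (rule param_shift[OF assms]) (assumption, rule that, assumption+)
  have "((\<lambda>s. snd (\<delta> (s + s\<^sub>0)) - snd (\<gamma> s)) has_real_derivative 0) (at s within A)"
    if s: "s \<in> A" for s
  proof -
    have "s + s\<^sub>0 \<in> B"
      using s B by blast
    then have "((\<lambda>t. snd (\<delta> t)) has_real_derivative momentum A \<gamma> s)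
        (at (s + s\<^sub>0) within (\<lambda>s. s + s\<^sub>0) ` A)"
      using B.z_deriv[of "s + s\<^sub>0"] K[OF s] by (simp add: B.momentum_eq flip: B)
    moreover have "((\<lambda>s. s + s\<^sub>0) has_real_derivative 1) (at s within A)"
      by (auto intro!: derivative_eq_intros)
    ultimately have "((\<lambda>s. snd (\<delta> (s + s\<^sub>0))) has_real_derivative momentum A \<gamma> s) (at s within A)"
      using DERIV_image_chain[of "\<lambda>t. snd (\<delta> t)" _ "\<lambda>s. s + s\<^sub>0" s A 1] by (simp add: o_def)
    then show ?thesis
      using A.z_deriv[OF s] by (auto intro!: derivative_eq_intros simp: A.momentum_eq)
  qed
  then obtain c where "\<And>s. s \<in> A \<Longrightarrow> snd (\<delta> (s + s\<^sub>0)) - snd (\<gamma> s) = c"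
    using constant_on_if_deriv_zero[OF A.proper, of "\<lambda>s. snd (\<delta> (s + s\<^sub>0)) - snd (\<gamma> s)"] by blast
  then have "\<forall>s\<in>A. \<delta> (s + s\<^sub>0) = \<gamma> s + (0, c)"
    using x by (auto simp: prod_eq_iff algebra_simps)
  then show ?thesis
    using B by blast
qed

section \<open>The momentum determines the curve\<close>

theorem corollary2p4:
  fixes I J :: "real set" and \<alpha> \<beta> :: "real \<Rightarrow> real \<times> real"
  assumes "arc_length_curve I \<alpha>" and "\<not> (\<lambda>s. fst (\<alpha> s)) constant_on I"
    and "arc_length_curve J \<beta>" and "\<not> (\<lambda>s. fst (\<beta> s)) constant_on J"
  shows "(\<exists>A \<gamma>. oriented_arc I \<alpha> A \<gamma>) \<and>
    (\<forall>A \<gamma>. oriented_arc I \<alpha> A \<gamma> \<longrightarrow>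
       inj_on (\<lambda>s. fst (\<gamma> s)) A \<and>
       (\<forall>u\<in>x_range A \<gamma>. - 1 < momentum_of_x A \<gamma> u \<and> momentum_of_x A \<gamma> u < 1) \<and>
       (\<forall>u\<in>x_range A \<gamma>.
          (momentum_of_x A \<gamma> has_real_derivative curvature_of_x A \<gamma> u) (at u within x_range A \<gamma>))) \<and>
    (\<forall>A \<gamma> B \<delta>. oriented_arc I \<alpha> A \<gamma> \<and> oriented_arc J \<beta> B \<delta> \<and>
       x_range A \<gamma> = x_range B \<delta> \<and>
       (\<forall>u\<in>x_range A \<gamma>. momentum_of_x A \<gamma> u = momentum_of_x B \<delta> u) \<longrightarrow>
       (\<exists>s\<^sub>0 c. B = (\<lambda>s. s + s\<^sub>0) ` A \<and> (\<forall>s\<in>A. \<delta> (s + s\<^sub>0) = \<gamma> s + (0, c))))"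
proof (intro conjI allI impI ballI)
  show "\<exists>A \<gamma>. oriented_arc I \<alpha> A \<gamma>"
    using oriented_arc_exists assms by blast
next
  fix A \<gamma> assume "oriented_arc I \<alpha> A \<gamma>"
  then interpret rising_arc A \<gamma>
    using oriented_arc_rising_arc assms by blast
  show "inj_on (\<lambda>s. fst (\<gamma> s)) A"
    by (rule x_inj)
  fix u assume u: "u \<in> x_range A \<gamma>"
  show "- 1 < momentum_of_x A \<gamma> u" "momentum_of_x A \<gamma> u < 1"
    using abs_momentum_less_1[OF param_of_x_mem[OF u]] by (auto simp: momentum_of_x_def)
  show "(momentum_of_x A \<gamma> has_real_derivative curvature_of_x A \<gamma> u) (at u within x_range A \<gamma>)"
    by (rule momentum_of_x_deriv[OF u])
next
  fix A \<gamma> B \<delta>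
  assume arcs: "oriented_arc I \<alpha> A \<gamma> \<and> oriented_arc J \<beta> B \<delta> \<and> x_range A \<gamma> = x_range B \<delta> \<and>
    (\<forall>u\<in>x_range A \<gamma>. momentum_of_x A \<gamma> u = momentum_of_x B \<delta> u)"
  then have "rising_arc A \<gamma>" "rising_arc B \<delta>"
    using oriented_arc_rising_arc assms(1,3) by blast+
  then show "\<exists>s\<^sub>0 c. B = (\<lambda>s. s + s\<^sub>0) ` A \<and> (\<forall>s\<in>A. \<delta> (s + s\<^sub>0) = \<gamma> s + (0, c))"
    by (rule rising_arc_unique) (use arcs in auto)
qed

end
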